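(* Let $(E,\pi,B)$ be a real vector bundle with $n$-dimensional fibres and $L$ a linear transport along paths in it, whose matrix in given bases along a path $\gamma:J\to B$ is $H(t,s;\gamma)=F^{-1}(t;\gamma)F(s;\gamma)$ for a nondegenerate matrix function $F$. Then any bundle metric along $\gamma$ that is consistent with $L$ along $\gamma$ has a matrix of the form $$G(\gamma(s);\gamma)=\bigl(F(s;\gamma)\bigr)^{T}C(\gamma)F(s;\gamma),\qquad s\in J,$$ where $C(\gamma)=C(\gamma)^T$ is a nondegenerate symmetric matrix depending on $\gamma$ (but not on $s$).
   Context: A path in $B$ is a (continuous) map $\gamma:J\to B$ with $J$ an arbitrary real interval. A linear transport along paths $L$ assigns to each path $\gamma:J\to B$ and $s,t\in J$ a linear map $L^\gamma_{s\to t}:\pi^{-1}(\gamma(s))\to\pi^{-1}(\gamma(t))$ with $L^\gamma_{t\to r}\circ L^\gamma_{s\to t}=L^\gamma_{s\to r}$ and $L^\gamma_{s\to s}=\mathrm{id}$ for all $r,s,t\in J$. A bundle metric along $\gamma$ is a family, indexed by $s\in J$, of symmetric nondegenerate bilinear forms $g_{\gamma(s)}$ on the real vector spaces $\pi^{-1}(\gamma(s))$. It is consistent with $L$ along $\gamma$ if $g_{\gamma(s)}(u,v)=g_{\gamma(t)}(L^\gamma_{s\to t}u,L^\gamma_{s\to t}v)$ for all $s,t\in J$ and $u,v\in\pi^{-1}(\gamma(s))$. Matrices: in bases $\{e_i(s)\}$ of $\pi^{-1}(\gamma(s))$, $H(t,s;\gamma)=[H^{i}_{\;j}(t,s;\gamma)]$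 is defined by $L^\gamma_{s\to t}e_j(s)=\sum_i H^{i}_{\;j}(t,s;\gamma)e_i(t)$, and $G(\gamma(s);\gamma)=[g_{\gamma(s)}(e_i(s),e_j(s))]_{ij}$. *)

theory Defs
  imports "HOL-Analysis.Analysis" "HOL-Algebra.Algebraic_Closure_Type"
begin

text \<open>A real vector space with an explicit carrier is a module, in the sense of HOL-Algebra,
  over the type \<open>real\<close> viewed as a ring record. The record fields \<open>mult\<close> and \<open>one\<close> that
  a module inherits from the ring record carry no meaning.\<close>

abbreviation real_ring :: "real ring" where
  "real_ring \<equiv> ring_of_type_algebra"

definition linear_on ::
    "(real, 'e) module \<Rightarrow> (real, 'f) module \<Rightarrow> ('e \<Rightarrow> 'f) \<Rightarrow> bool" where
  "linear_on V W f \<longleftrightarrow>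
     (\<forall>u\<in>carrier V. f u \<in> carrier W) \<and>
     (\<forall>u\<in>carrier V. \<forall>v\<in>carrier V. f (u \<oplus>\<^bsub>V\<^esub> v) = f u \<oplus>\<^bsub>W\<^esub> f v) \<and>
     (\<forall>a. \<forall>u\<in>carrier V. f (a \<odot>\<^bsub>V\<^esub> u) = a \<odot>\<^bsub>W\<^esub> f u)"

definition linear_combination ::
    "(real, 'e) module \<Rightarrow> real ^ 'n \<Rightarrow> ('n::finite \<Rightarrow> 'e) \<Rightarrow> 'e" where
  "linear_combination V c e = (\<Oplus>\<^bsub>V\<^esub>i\<in>UNIV. (c $ i) \<odot>\<^bsub>V\<^esub> e i)"

definition basis_of :: "(real, 'e) module \<Rightarrow> ('n::finite \<Rightarrow> 'e) \<Rightarrow> bool" where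
  "basis_of V e \<longleftrightarrow>
     (\<forall>i. e i \<in> carrier V) \<and>
     (\<forall>c. linear_combination V c e = \<zero>\<^bsub>V\<^esub> \<longrightarrow> c = 0) \<and>
     (\<forall>v\<in>carrier V. \<exists>c. v = linear_combination V c e)"

definition bilinear_form_on :: "(real, 'e) module \<Rightarrow> ('e \<Rightarrow> 'e \<Rightarrow> real) \<Rightarrow> bool" where
  "bilinear_form_on V b \<longleftrightarrow>
     (\<forall>u\<in>carrier V. \<forall>v\<in>carrier V. \<forall>w\<in>carrier V.
        b (u \<oplus>\<^bsub>V\<^esub> v) w = b u w + b v w \<and> b w (u \<oplus>\<^bsub>V\<^esub> v) = b w u + b w v) \<and>
     (\<forall>a. \<forall>u\<in>carrier V. \<forall>v\<in>carrier V.
        b (a \<odot>\<^bsub>V\<^esub> u) v = a * b u v \<and> b u (a \<odot>\<^bsub>V\<^esub> v) = a * b u v)"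

definition symmetric_form_on :: "(real, 'e) module \<Rightarrow> ('e \<Rightarrow> 'e \<Rightarrow> real) \<Rightarrow> bool" where
  "symmetric_form_on V b \<longleftrightarrow> (\<forall>u\<in>carrier V. \<forall>v\<in>carrier V. b u v = b v u)"

text \<open>Triviality of the left radical; only used for symmetric forms.\<close>

definition nondegenerate_form_on :: "(real, 'e) module \<Rightarrow> ('e \<Rightarrow> 'e \<Rightarrow> real) \<Rightarrow> bool" where
  "nondegenerate_form_on V b \<longleftrightarrow>
     (\<forall>u\<in>carrier V. (\<forall>v\<in>carrier V. b u v = 0) \<longrightarrow> u = \<zero>\<^bsub>V\<^esub>)"

text \<open>A real topological vector bundle \<open>p : E \<rightarrow> B\<close> whose fibres have dimension
  \<open>CARD('n)\<close>. The record \<open>V x\<close> is the vector space structure on the fibre over \<open>x\<close>; it is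
  unconstrained outside \<open>B\<close>. A local trivialization \<open>\<phi>\<close> is linear on each fibre and, being a
  homeomorphism over \<open>U\<close>, bijective from each fibre onto \<open>{x} \<times> (real ^ 'n)\<close>, which
  fixes the dimension.\<close>

locale real_vector_bundle =
  fixes dimension :: "'n::finite itself"
    and E :: "'e topology" and p :: "'e \<Rightarrow> 'b" and B :: "'b topology"
    and V :: "'b \<Rightarrow> (real, 'e) module"
  assumes continuous_projection: "continuous_map E B p"
    and carrier_fibre: "\<And>x. x \<in> topspace B \<Longrightarrow> carrier (V x) = {u \<in> topspace E. p u = x}"
    and module_fibre: "\<And>x. x \<in> topspace B \<Longrightarrow> Module.module real_ring (V x)"
    and locally_trivial: "\<And>x. x \<in> topspace B \<Longrightarrow>
      \<exists>U \<phi>. openin B U \<and> x \<in> U \<and>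
        homeomorphic_map (subtopology E {u \<in> topspace E. p u \<in> U})
          (prod_topology (subtopology B U) (euclidean :: (real ^ 'n) topology)) \<phi> \<and>
        (\<forall>u\<in>topspace E. p u \<in> U \<longrightarrow> fst (\<phi> u) = p u) \<and>
        (\<forall>y\<in>U. \<forall>u\<in>carrier (V y). \<forall>v\<in>carrier (V y).
           snd (\<phi> (u \<oplus>\<^bsub>V y\<^esub> v)) = snd (\<phi> u) + snd (\<phi> v)) \<and>
        (\<forall>y\<in>U. \<forall>a. \<forall>u\<in>carrier (V y).
           snd (\<phi> (a \<odot>\<^bsub>V y\<^esub> u)) = a *\<^sub>R snd (\<phi> u))"

text \<open>A path is a map with domain \<open>J\<close>; extensionality makes its encoding as a total function
  unique, so that a transport can depend only on the values of the path on \<open>J\<close>.\<close>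

definition path_on :: "'b topology \<Rightarrow> real set \<Rightarrow> (real \<Rightarrow> 'b) \<Rightarrow> bool" where
  "path_on B J \<gamma> \<longleftrightarrow>
     is_interval J \<and> \<gamma> \<in> extensional J \<and> continuous_map (top_of_set J) B \<gamma>"

text \<open>\<open>L J \<gamma> s t\<close> is the transport from the fibre over \<open>\<gamma> s\<close> to the fibre over \<open>\<gamma> t\<close>.\<close>

definition linear_transport ::
    "'b topology \<Rightarrow> ('b \<Rightarrow> (real, 'e) module) \<Rightarrow>
     (real set \<Rightarrow> (real \<Rightarrow> 'b) \<Rightarrow> real \<Rightarrow> real \<Rightarrow> 'e \<Rightarrow> 'e) \<Rightarrow> bool" where
  "linear_transport B V L \<longleftrightarrow>
     (\<forall>J \<gamma>. path_on B J \<gamma> \<longrightarrow>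
        (\<forall>s\<in>J. \<forall>t\<in>J. linear_on (V (\<gamma> s)) (V (\<gamma> t)) (L J \<gamma> s t)) \<and>
        (\<forall>r\<in>J. \<forall>s\<in>J. \<forall>t\<in>J. \<forall>u\<in>carrier (V (\<gamma> s)).
           L J \<gamma> t r (L J \<gamma> s t u) = L J \<gamma> s r u) \<and>
        (\<forall>s\<in>J. \<forall>u\<in>carrier (V (\<gamma> s)). L J \<gamma> s s u = u))"

text \<open>The family is indexed by the parameter \<open>s\<close>, so at a self-intersection
  \<open>\<gamma> s = \<gamma> t\<close> the forms \<open>g s\<close> and \<open>g t\<close> may differ.\<close>

definition bundle_metric_along ::
    "('b \<Rightarrow> (real, 'e) module) \<Rightarrow> real set \<Rightarrow> (real \<Rightarrow> 'b) \<Rightarrow>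
     (real \<Rightarrow> 'e \<Rightarrow> 'e \<Rightarrow> real) \<Rightarrow> bool" where
  "bundle_metric_along V J \<gamma> g \<longleftrightarrow>
     (\<forall>s\<in>J. bilinear_form_on (V (\<gamma> s)) (g s) \<and>
            symmetric_form_on (V (\<gamma> s)) (g s) \<and>
            nondegenerate_form_on (V (\<gamma> s)) (g s))"

definition consistent_along ::
    "('b \<Rightarrow> (real, 'e) module) \<Rightarrow>
     (real set \<Rightarrow> (real \<Rightarrow> 'b) \<Rightarrow> real \<Rightarrow> real \<Rightarrow> 'e \<Rightarrow> 'e) \<Rightarrow>
     real set \<Rightarrow> (real \<Rightarrow> 'b) \<Rightarrow> (real \<Rightarrow> 'e \<Rightarrow> 'e \<Rightarrow> real) \<Rightarrow> bool" where
  "consistent_along V L J \<gamma> g \<longleftrightarrow>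
     (\<forall>s\<in>J. \<forall>t\<in>J. \<forall>u\<in>carrier (V (\<gamma> s)). \<forall>v\<in>carrier (V (\<gamma> s)).
        g s u v = g t (L J \<gamma> s t u) (L J \<gamma> s t v))"

definition bases_along ::
    "('b \<Rightarrow> (real, 'e) module) \<Rightarrow> real set \<Rightarrow> (real \<Rightarrow> 'b) \<Rightarrow>
     (real \<Rightarrow> 'n::finite \<Rightarrow> 'e) \<Rightarrow> bool" where
  "bases_along V J \<gamma> e \<longleftrightarrow> (\<forall>s\<in>J. basis_of (V (\<gamma> s)) (e s))"

text \<open>\<open>H t s\<close> is the matrix of \<open>L J \<gamma> s t\<close>: note the reversed order of the arguments. Its
  \<open>j\<close>-th column consists of the components of the transported \<open>j\<close>-th basis vector.\<close>

definition is_transport_matrix ::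
    "('b \<Rightarrow> (real, 'e) module) \<Rightarrow>
     (real set \<Rightarrow> (real \<Rightarrow> 'b) \<Rightarrow> real \<Rightarrow> real \<Rightarrow> 'e \<Rightarrow> 'e) \<Rightarrow>
     real set \<Rightarrow> (real \<Rightarrow> 'b) \<Rightarrow> (real \<Rightarrow> 'n::finite \<Rightarrow> 'e) \<Rightarrow>
     (real \<Rightarrow> real \<Rightarrow> real ^ 'n ^ 'n) \<Rightarrow> bool" where
  "is_transport_matrix V L J \<gamma> e H \<longleftrightarrow>
     (\<forall>s\<in>J. \<forall>t\<in>J. \<forall>j.
        L J \<gamma> s t (e s j) = linear_combination (V (\<gamma> t)) (\<chi> i. H t s $ i $ j) (e t))"

definition metric_matrix ::
    "(real \<Rightarrow> 'e \<Rightarrow> 'e \<Rightarrow> real) \<Rightarrow> (real \<Rightarrow> 'n::finite \<Rightarrow> 'e) \<Rightarrow> real \<Rightarrow> real ^ 'n ^ 'n" where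
  "metric_matrix g e s = (\<chi> i j. g s (e s i) (e s j))"

end

theory Submission
  imports Defs
begin

text \<open>In components, consistency reads \<open>G(s) = H(t,s)\<^sup>T G(t) H(t,s)\<close>. Fixing \<open>t = s\<^sub>0\<close> and
  inserting \<open>H(s\<^sub>0,s) = F(s\<^sub>0)\<inverse> F(s)\<close> leaves \<open>s\<close> only in the outer factors, with
  \<open>C = (F(s\<^sub>0)\<inverse>)\<^sup>T G(s\<^sub>0) F(s\<^sub>0)\<inverse>\<close> in between.\<close>

text \<open>\<open>matrix_inv\<close> is a Hilbert choice, so it has its defining property as soon
  as some two-sided inverse exists; that property is symmetric in the two matrices.\<close>

lemma invertible_matrix_inv:
  fixes A :: "real ^ 'n ^ 'n"
  assumes "invertible A"
  shows "invertible (matrix_inv A)"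
proof -
  obtain A' where "A ** A' = mat 1 \<and> A' ** A = mat 1"
    using assms unfolding invertible_def by blast
  then have "A ** matrix_inv A = mat 1 \<and> matrix_inv A ** A = mat 1"
    unfolding matrix_inv_def by (rule someI)
  then show ?thesis
    unfolding invertible_def by blast
qed

lemma smult_in_carrier:
  assumes "Module.module real_ring V" "u \<in> carrier V"
  shows "a \<odot>\<^bsub>V\<^esub> u \<in> carrier V"
  using module.smult_closed[OF assms(1), of a u] assms(2)
  by (simp add: ring_of_type_algebra_def)

lemma linear_combination_in_carrier:
  assumes V: "Module.module real_ring V" and e: "\<And>i. e i \<in> carrier V"
  shows "linear_combination V c e \<in> carrier V"
proof -
  interpret M: Module.module real_ring V by (rule V)
  show ?thesis
    unfolding linear_combination_def
    by (rule M.M.finsum_closed) (auto intro: smult_in_carrier[OF V] e)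
qed

text \<open>Meant for a bilinear form with one argument frozen: either slot then becomes a linear
  functional \<open>f\<close> on the carrier.\<close>

lemma additive_linear_combination:
  fixes f :: "'e \<Rightarrow> real" and e :: "'n::finite \<Rightarrow> 'e"
  assumes V: "Module.module real_ring V" and e: "\<And>i. e i \<in> carrier V"
    and add: "\<And>u v. u \<in> carrier V \<Longrightarrow> v \<in> carrier V \<Longrightarrow> f (u \<oplus>\<^bsub>V\<^esub> v) = f u + f v"
    and scale: "\<And>a u. u \<in> carrier V \<Longrightarrow> f (a \<odot>\<^bsub>V\<^esub> u) = a * f u"
  shows "f (linear_combination V c e) = (\<Sum>i\<in>UNIV. c $ i * f (e i))"
proof -
  interpret M: Module.module real_ring V by (rule V)
  have ce: "c $ i \<odot>\<^bsub>V\<^esub> e i \<in> carrier V" for i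
    by (rule smult_in_carrier[OF V e])
  \<comment> \<open>Additivity at zero gives \<open>f 0 = f 0 + f 0\<close>; this is the base case
    of the induction over index sets.\<close>
  have zero: "f (\<zero>\<^bsub>V\<^esub>) = 0"
    using add[of "\<zero>\<^bsub>V\<^esub>" "\<zero>\<^bsub>V\<^esub>"] by simp
  have "f (\<Oplus>\<^bsub>V\<^esub>i\<in>A. c $ i \<odot>\<^bsub>V\<^esub> e i) = (\<Sum>i\<in>A. c $ i * f (e i))" if "finite A" for A
    using that
    by (induction A rule: finite_induct) (simp_all add: zero ce add scale e M.M.finsum_closed Pi_def)
  then show ?thesis
    unfolding linear_combination_def by simp
qed

lemma bilinear_form_linear_combination:
  assumes V: "Module.module real_ring V" and b: "bilinear_form_on V b"
    and e: "\<And>i. e i \<in> carrier V" and u: "u \<in> carrier V"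
  shows "b (linear_combination V c e) u = (\<Sum>i\<in>UNIV. c $ i * b (e i) u)"
    and "b u (linear_combination V c e) = (\<Sum>i\<in>UNIV. c $ i * b u (e i))"
  using b u by (auto simp: bilinear_form_on_def intro!: additive_linear_combination V e)

lemma bilinear_form_gram:
  assumes V: "Module.module real_ring V" and b: "bilinear_form_on V b"
    and e: "\<And>i. e i \<in> carrier V"
  shows "b (linear_combination V c e) (linear_combination V d e) =
    (\<Sum>i\<in>UNIV. \<Sum>j\<in>UNIV. c $ i * b (e i) (e j) * d $ j)"
  by (simp add: bilinear_form_linear_combination(1)[OF V b e linear_combination_in_carrier[OF V e]]
      bilinear_form_linear_combination(2)[OF V b e e] sum_distrib_left mult_ac)

text \<open>The kernel of the Gram matrix is trivial: a kernel vector lists the coordinates of a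
  vector orthogonal to every basis vector, hence to the whole space. Nondegeneracy makes that vector
  zero, and independence of the basis makes its coordinates zero.\<close>

lemma invertible_gram_matrix:
  fixes e :: "'n::finite \<Rightarrow> 'e"
  assumes V: "Module.module real_ring V" and b: "bilinear_form_on V b"
    and sym: "symmetric_form_on V b" and nondeg: "nondegenerate_form_on V b"
    and basis: "basis_of V e"
  shows "invertible ((\<chi> i j. b (e i) (e j)) :: real ^ 'n ^ 'n)"
proof -
  let ?G = "(\<chi> i j. b (e i) (e j)) :: real ^ 'n ^ 'n"
  have e: "\<And>i. e i \<in> carrier V"
    using basis by (simp add: basis_of_def)
  have "c = 0" if "?G *v c = 0" for c
  proof -
    let ?u = "linear_combination V c e"
    have u: "?u \<in> carrier V"
      by (rule linear_combination_in_carrier[OF V e])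
    \<comment> \<open>The product \<open>?G *v c\<close> sums over the second argument of
      \<open>b\<close>, while the radical is tested with \<open>?u\<close> in the first; symmetry
      reconciles the two.\<close>
    have "b ?u (e j) = (?G *v c) $ j" for j
      using sym e
      by (simp add: bilinear_form_linear_combination[OF V b e] matrix_vector_mult_def
          symmetric_form_on_def mult.commute)
    then have ue: "b ?u (e j) = 0" for j
      using that by simp
    have "b ?u v = 0" if v: "v \<in> carrier V" for v
    proof -
      obtain d where "v = linear_combination V d e"
        using basis v unfolding basis_of_def by blast
      then show ?thesis
        by (simp add: bilinear_form_linear_combination(2)[OF V b e u] ue)
    qed
    then have "?u = \<zero>\<^bsub>V\<^esub>"
      using nondeg u by (simp add: nondegenerate_form_on_def)
    then show "c = 0"
      using basis by (simp add: basis_of_def)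
  qed
  then show ?thesis
    using invertible_left_inverse matrix_left_invertible_ker by blast
qed

text \<open>Columns \<open>i\<close> and \<open>j\<close> of \<open>H t s\<close> are the
  coordinates of the transported basis vectors, so expanding \<open>g t\<close> on them yields the
  \<open>(i, j)\<close> entry of the product.\<close>

lemma metric_matrix_transport:
  fixes e :: "real \<Rightarrow> 'n::finite \<Rightarrow> 'e"
  assumes V: "\<And>s. s \<in> J \<Longrightarrow> Module.module real_ring (V (\<gamma> s))"
    and bases: "bases_along V J \<gamma> e" and matrix: "is_transport_matrix V L J \<gamma> e H"
    and metric: "bundle_metric_along V J \<gamma> g" and consistent: "consistent_along V L J \<gamma> g"
    and s: "s \<in> J" and t: "t \<in> J"
  shows "metric_matrix g e s = transpose (H t s) ** metric_matrix g e t ** H t s"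
proof -
  have e: "\<And>r i. r \<in> J \<Longrightarrow> e r i \<in> carrier (V (\<gamma> r))"
    using bases by (simp add: bases_along_def basis_of_def)
  have b: "bilinear_form_on (V (\<gamma> t)) (g t)"
    using metric t by (simp add: bundle_metric_along_def)
  have "metric_matrix g e s $ i $ j = (transpose (H t s) ** metric_matrix g e t ** H t s) $ i $ j"
    for i j
  proof -
    have "g s (e s i) (e s j) = g t (L J \<gamma> s t (e s i)) (L J \<gamma> s t (e s j))"
      using consistent s t e[OF s] unfolding consistent_along_def by blast
    also have "\<dots> = g t (linear_combination (V (\<gamma> t)) (\<chi> k. H t s $ k $ i) (e t))
        (linear_combination (V (\<gamma> t)) (\<chi> k. H t s $ k $ j) (e t))"
      using matrix s t by (simp add: is_transport_matrix_def)
    also have "\<dots> = (\<Sum>k\<in>UNIV. \<Sum>l\<in>UNIV. H t s $ k $ i * g t (e t k) (e t l) * H t s $ l $ j)"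
      by (simp add: bilinear_form_gram[OF V[OF t] b e[OF t]])
    \<comment> \<open>The triple product associates to the left, so its entries unfold with the
      index of the last factor outermost.\<close>
    also have "\<dots> = (\<Sum>l\<in>UNIV. \<Sum>k\<in>UNIV. H t s $ k $ i * g t (e t k) (e t l) * H t s $ l $ j)"
      by (rule sum.swap)
    also have "\<dots> = (transpose (H t s) ** metric_matrix g e t ** H t s) $ i $ j"
      by (simp add: matrix_matrix_mult_def transpose_def metric_matrix_def sum_distrib_right)
    finally show ?thesis
      by (simp add: metric_matrix_def)
  qed
  then show ?thesis
    by (simp add: vec_eq_iff)
qed

theorem proposition2p3:
  fixes E :: "'e topology" and p :: "'e \<Rightarrow> 'b" and B :: "'b topology"
    and V :: "'b \<Rightarrow> (real, 'e) module"
    and L :: "real set \<Rightarrow> (real \<Rightarrow> 'b) \<Rightarrow> real \<Rightarrow> real \<Rightarrow> 'e \<Rightarrow> 'e"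
    and J :: "real set" and \<gamma> :: "real \<Rightarrow> 'b"
    and e :: "real \<Rightarrow> 'n::finite \<Rightarrow> 'e"
    and H :: "real \<Rightarrow> real \<Rightarrow> real ^ 'n ^ 'n"
    and F :: "real \<Rightarrow> real ^ 'n ^ 'n"
    and g :: "real \<Rightarrow> 'e \<Rightarrow> 'e \<Rightarrow> real"
  assumes vector_bundle: "real_vector_bundle TYPE('n) E p B V"
    and transport: "linear_transport B V L"
    and path: "path_on B J \<gamma>"
    and bases: "bases_along V J \<gamma> e"
    and matrix: "is_transport_matrix V L J \<gamma> e H"
    and F_nondegenerate: "\<And>s. s \<in> J \<Longrightarrow> invertible (F s)"
    and H_eq: "\<And>s t. s \<in> J \<Longrightarrow> t \<in> J \<Longrightarrow> H t s = matrix_inv (F t) ** F s"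
    and metric: "bundle_metric_along V J \<gamma> g"
    and consistent: "consistent_along V L J \<gamma> g"
  shows "\<exists>C :: real ^ 'n ^ 'n. transpose C = C \<and> invertible C \<and>
    (\<forall>s\<in>J. metric_matrix g e s = transpose (F s) ** C ** F s)"
\<comment> \<open>An empty interval offers no base point, but then the equation for \<open>s\<close>
  is vacuous and any invertible symmetric matrix serves.\<close>
proof (cases "J = {}")
  case True
  then show ?thesis
    by (intro exI[of _ "mat 1"]) (simp add: transpose_mat invertible_def)
next
  case False
  then obtain r where r: "r \<in> J" by blast
  \<comment> \<open>Fibres are known to be modules only over \<open>topspace B\<close>, where the
    path takes its values on \<open>J\<close>.\<close>
  have V: "Module.module real_ring (V (\<gamma> s))" if "s \<in> J" for s
  proof -
    have "\<gamma> s \<in> topspace B"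
      using path that by (auto simp: path_on_def continuous_map_def)
    then show ?thesis
      by (rule real_vector_bundle.module_fibre[OF vector_bundle])
  qed
  let ?G = "metric_matrix g e" and ?K = "matrix_inv (F r)"
  define C where "C = transpose ?K ** ?G r ** ?K"
  have g: "bilinear_form_on (V (\<gamma> r)) (g r)" "symmetric_form_on (V (\<gamma> r)) (g r)"
    "nondegenerate_form_on (V (\<gamma> r)) (g r)"
    using metric r by (simp_all add: bundle_metric_along_def)
  have basis: "basis_of (V (\<gamma> r)) (e r)"
    using bases r by (simp add: bases_along_def)
  have "transpose (?G r) = ?G r"
    using g(2) basis
    by (simp add: vec_eq_iff transpose_def metric_matrix_def symmetric_form_on_def basis_of_def)
  then have "transpose C = C"
    by (simp add: C_def matrix_transpose_mul matrix_mul_assoc)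
  moreover have "invertible C"
  proof -
    have "invertible (?G r)"
      unfolding metric_matrix_def by (rule invertible_gram_matrix[OF V[OF r] g basis])
    moreover have "invertible ?K"
      by (rule invertible_matrix_inv[OF F_nondegenerate[OF r]])
    ultimately show ?thesis
      by (simp add: C_def invertible_mult transpose_invertible)
  qed
  \<comment> \<open>Transport goes from \<open>s\<close> to the base point \<open>r\<close>, with
    \<open>H r s = ?K ** F s\<close>; \<open>C\<close> absorbs \<open>?K\<close> on the right and
    its transpose on the left.\<close>
  moreover have "?G s = transpose (F s) ** C ** F s" if "s \<in> J" for s
    using metric_matrix_transport[OF V bases matrix metric consistent that r]
    by (simp add: H_eq[OF that r] C_def matrix_transpose_mul matrix_mul_assoc)
  ultimately show ?thesis by blast
qed

end
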